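(* Let $\Omega=[0,1]^n$, let $f:\Omega\to\mathbb{R}$ be continuously differentiable with each partial derivative $\partial_i f$ being $L_i$-Lipschitz continuous on $\Omega$ ($i=1,\dots,n$), and let $\sigma\in\mathbb{R}^n$ satisfy $\sigma_i>0$ for all $i$. Let $y^*\in\Omega$ be a KKT point of the problem $\min_{y\in\Omega} f(y)$, let $\{y_k\}\subset(0,1)^n$ be a sequence converging to $y^*$, and let $x_k=S^{-1}(y_k)\in\mathbb{R}^n$ for all $k$. Then $\nabla\tilde f_\sigma(x_k)\to 0$ as $k\to\infty$.
   Context: For $\sigma\in\mathbb{R}^n$ with all entries strictly positive, the sigmoidal warping $S:\mathbb{R}^n\to(0,1)^n$ is defined componentwise by $S(x)_i=\frac{1}{1+e^{-\sigma_i x_i}}$; it is a bijection onto $(0,1)^n$. The merit function is $\tilde f_\sigma:\mathbb{R}^n\to\mathbb{R}$, $\tilde f_\sigma(x)=f(S(x))$. A point $y^*\in[0,1]^n$ is a KKT point of $\min_{y\in[0,1]^n} f(y)$ if there exist $\lambda,\mu\in\mathbb{R}^n$ with $\lambda\le 0$, $\mu\le 0$ (componentwise), $\nabla f(y^* )+\lambda-\mu=0$, and $\lambda_i y_i^*=0$, $\mu_i(1-y_i^* )=0$ for $i=1,\dots,n$. *)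

theory Defs
  imports "HOL-Analysis.Analysis"
begin

text \<open>
  The derivative is taken within the set \<open>A\<close>, so that on the boundary of the closed cube it is the
  usual one-sided notion. \<open>frechet_derivative\<close> chooses some derivative; on the cube and on
  the whole space there is only one, see \<open>has_derivative_cube_imp_gradient\<close>.
\<close>

definition partial_derivative_within ::
    "(real ^ 'n \<Rightarrow> real) \<Rightarrow> 'n \<Rightarrow> real ^ 'n \<Rightarrow> (real ^ 'n) set \<Rightarrow> real" where
  "partial_derivative_within f i x A = frechet_derivative f (at x within A) (axis i 1)"

definition gradient_within ::
    "(real ^ 'n \<Rightarrow> real) \<Rightarrow> real ^ 'n \<Rightarrow> (real ^ 'n) set \<Rightarrow> real ^ 'n" where
  "gradient_within f x A = (\<chi> i. partial_derivative_within f i x A)"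

abbreviation gradient :: "(real ^ 'n \<Rightarrow> real) \<Rightarrow> real ^ 'n \<Rightarrow> real ^ 'n" where
  "gradient f x \<equiv> gradient_within f x UNIV"

definition continuously_differentiable_on ::
    "(real ^ 'n \<Rightarrow> real) \<Rightarrow> (real ^ 'n) set \<Rightarrow> bool" where
  "continuously_differentiable_on f A \<longleftrightarrow>
     f differentiable_on A \<and> continuous_on A (\<lambda>x. gradient_within f x A)"

definition sigmoidal_warping :: "real ^ 'n \<Rightarrow> real ^ 'n \<Rightarrow> real ^ 'n" where
  "sigmoidal_warping \<sigma> x = (\<chi> i. 1 / (1 + exp (- (\<sigma> $ i * x $ i))))"

definition merit :: "(real ^ 'n \<Rightarrow> real) \<Rightarrow> real ^ 'n \<Rightarrow> real ^ 'n \<Rightarrow> real" where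
  "merit f \<sigma> x = f (sigmoidal_warping \<sigma> x)"

definition kkt_point :: "(real ^ 'n \<Rightarrow> real) \<Rightarrow> real ^ 'n \<Rightarrow> bool" where
  "kkt_point f y \<longleftrightarrow> y \<in> cbox 0 1 \<and>
     (\<exists>lam mu :: real ^ 'n.
        (\<forall>i. lam $ i \<le> 0) \<and> (\<forall>i. mu $ i \<le> 0) \<and>
        gradient_within f y (cbox 0 1) + lam - mu = 0 \<and>
        (\<forall>i. lam $ i * y $ i = 0) \<and> (\<forall>i. mu $ i * (1 - y $ i) = 0))"

lemma has_derivative_cube_imp_gradient:
  fixes f :: "real ^ 'n \<Rightarrow> real"
  assumes "y \<in> cbox 0 1" "(f has_derivative (\<lambda>h. g \<bullet> h)) (at y within cbox 0 1)"
  shows "gradient_within f y (cbox 0 1) = g"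
proof -
  have d: "(f has_derivative frechet_derivative f (at y within cbox 0 1)) (at y within cbox 0 1)"
    using assms(2) differentiableI frechet_derivative_works by blast
  have "frechet_derivative f (at y within cbox 0 1) = (\<lambda>h. g \<bullet> h)"
  proof (rule frechet_derivative_unique_within_closed_interval[OF _ _ d assms(2)])
    show "(0::real ^ 'n) \<bullet> i < 1 \<bullet> i" if "i \<in> Basis" for i :: "real ^ 'n"
      using that by (auto simp: Basis_vec_def inner_axis)
  qed (use assms(1) in auto)
  then show ?thesis
    by (simp add: gradient_within_def partial_derivative_within_def vec_eq_iff inner_axis)
qed

lemma bij_betw_sigmoidal_warping:
  fixes \<sigma> :: "real ^ 'n"
  assumes "\<And>i. \<sigma> $ i > 0"
  shows "bij_betw (sigmoidal_warping \<sigma>) UNIV (box 0 1)"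
proof (rule bij_betw_byWitness[where f' = "\<lambda>y. \<chi> i. ln (y $ i / (1 - y $ i)) / \<sigma> $ i"])
  have pos: "1 + exp t > 0" for t :: real
    by (simp add: add_pos_pos)
  have "1 / (1 + exp (- t)) / (1 - 1 / (1 + exp (- t))) = exp t" for t :: real
    using pos[of "- t"] by (simp add: field_simps exp_minus)
  moreover have "\<sigma> $ i \<noteq> 0" for i
    using assms[of i] by simp
  ultimately show "\<forall>x\<in>UNIV. (\<chi> i. ln (sigmoidal_warping \<sigma> x $ i / (1 - sigmoidal_warping \<sigma> x $ i)) / \<sigma> $ i) = x"
    by (simp add: sigmoidal_warping_def vec_eq_iff)
  show "\<forall>y\<in>box 0 1. sigmoidal_warping \<sigma> (\<chi> i. ln (y $ i / (1 - y $ i)) / \<sigma> $ i) = y"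
  proof
    fix y :: "real ^ 'n" assume y: "y \<in> box 0 1"
    have "sigmoidal_warping \<sigma> (\<chi> i. ln (y $ i / (1 - y $ i)) / \<sigma> $ i) $ i = y $ i" for i
    proof -
      have *: "0 < y $ i" "y $ i < 1" "\<sigma> $ i \<noteq> 0"
        using y assms[of i] by (auto simp: mem_box_cart)
      have "exp (- ln (y $ i / (1 - y $ i))) = (1 - y $ i) / y $ i"
        using * by (simp add: exp_minus)
      moreover have "1 / (1 + (1 - y $ i) / y $ i) = y $ i"
        using * by (simp add: field_simps)
      ultimately show ?thesis
        using * by (simp add: sigmoidal_warping_def del: exp_minus)
    qed
    then show "sigmoidal_warping \<sigma> (\<chi> i. ln (y $ i / (1 - y $ i)) / \<sigma> $ i) = y"
      by (simp add: vec_eq_iff)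
  qed
  show "sigmoidal_warping \<sigma> ` UNIV \<subseteq> box 0 1"
    using pos by (auto simp: sigmoidal_warping_def mem_box_cart)
  show "(\<lambda>y. \<chi> i. ln (y $ i / (1 - y $ i)) / \<sigma> $ i) ` box 0 1 \<subseteq> UNIV"
    by simp
qed

end

theory Submission
  imports Defs
begin

text \<open>
  By the chain rule \<open>\<partial>\<^sub>i(f \<circ> S) = \<sigma>\<^sub>i y\<^sub>i (1 - y\<^sub>i) \<partial>\<^sub>i f(y)\<close> at \<open>y = S x\<close>. The right-hand side is continuous
  in \<open>y\<close> on the closed cube, and complementarity makes it vanish at a KKT point: multiplying
  \<open>\<partial>\<^sub>i f(y) = \<mu>\<^sub>i - \<lambda>\<^sub>i\<close> by \<open>y\<^sub>i (1 - y\<^sub>i)\<close> kills both multipliers, whatever their signs.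
\<close>

text \<open>The warping acts on each coordinate separately, so its Jacobian is diagonal, and a
  logistic function \<open>u\<close> with rate \<open>c\<close> satisfies
  \<open>u' = c * u * (1 - u)\<close>. Writing the entries through \<open>s\<close> instead of
  \<open>x\<close> allows limits to be taken in the cube.\<close>

lemma has_derivative_sigmoidal_warping:
  fixes \<sigma> x :: "real ^ 'n"
  defines "s \<equiv> sigmoidal_warping \<sigma> x"
  shows "(sigmoidal_warping \<sigma> has_derivative
           (\<lambda>h. \<chi> i. \<sigma> $ i * (s $ i * (1 - s $ i)) * h $ i)) (at x)"
proof -
  have component: "((\<lambda>z. sigmoidal_warping \<sigma> z $ i) has_derivative
           (\<lambda>h. \<sigma> $ i * (s $ i * (1 - s $ i)) * h $ i)) (at x)" for i
  proof -
    have pos: "1 + exp t > 0" for t :: real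
      by (simp add: add_pos_pos)
    have nz: "1 + exp t \<noteq> 0" for t :: real
      using pos[of t] by linarith
    have coord: "((\<lambda>z. z $ i) has_derivative (\<lambda>h. h $ i)) (at x)"
      by (rule bounded_linear_imp_has_derivative) (rule bounded_linear_vec_nth)
    have sigmoid: "((\<lambda>t. inverse (1 + exp (- (\<sigma> $ i * t)))) has_field_derivative
             \<sigma> $ i * (s $ i * (1 - s $ i))) (at (x $ i))"
    proof -
      define e where "e = exp (- (\<sigma> $ i * x $ i))"
      have "((\<lambda>t. 1 + exp (- (\<sigma> $ i * t))) has_field_derivative - (\<sigma> $ i * e)) (at (x $ i))"
        by (auto intro!: derivative_eq_intros simp: e_def)
      from DERIV_inverse_fun[OF this nz]
      have "((\<lambda>t. inverse (1 + exp (- (\<sigma> $ i * t)))) has_field_derivative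
          \<sigma> $ i * (inverse (1 + e) * e * inverse (1 + e))) (at (x $ i))"
        by (simp add: e_def power2_eq_square mult_ac)
      moreover have "s $ i = inverse (1 + e)"
        by (simp add: s_def sigmoidal_warping_def e_def inverse_eq_divide)
      \<comment> \<open>This identity turns the factor \<open>e / (1 + e)^2\<close> from the
        quotient rule into \<open>s $ i * (1 - s $ i)\<close>.\<close>
      moreover have "1 - inverse (1 + e) = e * inverse (1 + e)"
        using nz[of "- (\<sigma> $ i * x $ i)"] unfolding e_def[symmetric] by (simp add: field_simps)
      ultimately show ?thesis
        by (simp only: mult_ac)
    qed
    from has_derivative_compose[OF coord sigmoid[unfolded has_field_derivative_def]]
    show ?thesis
      by (simp add: sigmoidal_warping_def inverse_eq_divide)
  qed
  \<comment> \<open>The basis vectors are \<open>axis i 1\<close>, so the inner products with them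
    are the coordinates treated in \<open>component\<close>.\<close>
  show ?thesis
    unfolding has_derivative_componentwise_within[of "sigmoidal_warping \<sigma>"]
    using component by (auto simp: Basis_vec_def inner_axis)
qed

lemma gradient_merit_nth:
  fixes f :: "real ^ 'n \<Rightarrow> real" and \<sigma> x :: "real ^ 'n"
  defines "s \<equiv> sigmoidal_warping \<sigma> x"
  assumes "f differentiable_on cbox 0 1" and "s \<in> box 0 1"
  shows "gradient (merit f \<sigma>) x $ i =
    \<sigma> $ i * (s $ i * (1 - s $ i)) * gradient_within f s (cbox 0 1) $ i"
proof -
  define f' where "f' = frechet_derivative f (at s within cbox 0 1)"
  let ?S' = "\<lambda>h. \<chi> j. \<sigma> $ j * (s $ j * (1 - s $ j)) * h $ j"
  have "s \<in> cbox 0 1"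
    using assms(3) box_subset_cbox by blast
  then have "(f has_derivative f') (at s within cbox 0 1)"
    using assms(2) unfolding f'_def differentiable_on_def by (simp add: frechet_derivative_works)
  \<comment> \<open>The cube is a neighbourhood of \<open>s\<close>, so the derivative within it is
    a full derivative and the chain rule applies at \<open>x\<close>.\<close>
  moreover have "at s within cbox 0 1 = at s"
    by (rule at_within_interior) (use assms(3) in simp)
  ultimately have f': "(f has_derivative f') (at s)"
    by simp
  have "(merit f \<sigma> has_derivative (\<lambda>h. f' (?S' h))) (at x)"
    using has_derivative_compose[OF has_derivative_sigmoidal_warping f'[unfolded s_def]]
    by (simp add: merit_def[abs_def] s_def)
  from frechet_derivative_at[OF this, symmetric]
  have "gradient (merit f \<sigma>) x $ i = f' (?S' (axis i 1))"
    by (simp add: gradient_within_def partial_derivative_within_def)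
  \<comment> \<open>The diagonal Jacobian only rescales a coordinate direction, so no other partial
    derivative of \<open>f\<close> enters.\<close>
  also have "?S' (axis i 1) = (\<sigma> $ i * (s $ i * (1 - s $ i))) *\<^sub>R axis i 1"
    by (simp add: vec_eq_iff axis_def)
  also have "f' \<dots> = \<sigma> $ i * (s $ i * (1 - s $ i)) * f' (axis i 1)"
    using linear_scale[OF has_derivative_linear[OF f']] by simp
  finally show ?thesis
    by (simp add: f'_def gradient_within_def partial_derivative_within_def)
qed

lemma kkt_point_complementarity:
  assumes "kkt_point f y"
  shows "y $ i * (1 - y $ i) * gradient_within f y (cbox 0 1) $ i = 0"
proof -
  obtain lam mu :: "real ^ 'a" where
    "gradient_within f y (cbox 0 1) + lam - mu = 0"
    and slack: "lam $ i * y $ i = 0" "mu $ i * (1 - y $ i) = 0"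
    using assms unfolding kkt_point_def by blast
  then have "gradient_within f y (cbox 0 1) = mu - lam"
    by (simp add: algebra_simps)
  then show ?thesis
    using slack by auto
qed

theorem theorem2:
  fixes f :: "real ^ 'n \<Rightarrow> real"
    and L :: "'n \<Rightarrow> real"
    and \<sigma> y_star :: "real ^ 'n"
    and x y :: "nat \<Rightarrow> real ^ 'n"
  assumes "continuously_differentiable_on f (cbox 0 1)"
    and "\<And>i. (L i)-lipschitz_on (cbox 0 1) (\<lambda>z. partial_derivative_within f i z (cbox 0 1))"
    and "\<And>i. \<sigma> $ i > 0"
    and "kkt_point f y_star"
    and "\<And>k. y k \<in> box 0 1"
    and "y \<longlonglongrightarrow> y_star"
    and "\<And>k. x k = inv (sigmoidal_warping \<sigma>) (y k)"
  shows "(\<lambda>k. gradient (merit f \<sigma>) (x k)) \<longlonglongrightarrow> 0"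
proof (rule vec_tendstoI)
  fix i
  let ?g = "\<lambda>z. gradient_within f z (cbox 0 1)"
  have diff: "f differentiable_on cbox 0 1" and cont: "continuous_on (cbox 0 1) ?g"
    using assms(1) by (auto simp: continuously_differentiable_on_def)
  \<comment> \<open>\<open>inv\<close> is a right inverse only on the range, which is the open cube
    containing every \<open>y k\<close>.\<close>
  have warp: "sigmoidal_warping \<sigma> (x k) = y k" for k
  proof -
    have "y k \<in> range (sigmoidal_warping \<sigma>)"
      using bij_betw_imp_surj_on[OF bij_betw_sigmoidal_warping[OF assms(3)]] assms(5) by auto
    then show ?thesis
      unfolding assms(7) by (rule f_inv_into_f)
  qed
  have "y_star \<in> cbox 0 1"
    using assms(4) by (simp add: kkt_point_def)
  moreover have "y k \<in> cbox 0 1" for k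
    using assms(5) box_subset_cbox by blast
  ultimately have "(\<lambda>k. ?g (y k)) \<longlonglongrightarrow> ?g y_star"
    using continuous_on_tendsto_compose[OF cont assms(6)] by simp
  \<comment> \<open>The limit is taken in \<open>y\<close> because \<open>x k\<close> diverges
    whenever \<open>y_star\<close> lies on the boundary of the cube.\<close>
  then have "(\<lambda>k. \<sigma> $ i * (y k $ i * (1 - y k $ i)) * ?g (y k) $ i)
      \<longlonglongrightarrow> \<sigma> $ i * (y_star $ i * (1 - y_star $ i)) * ?g y_star $ i"
    by (intro tendsto_intros assms(6))
  moreover have "\<sigma> $ i * (y_star $ i * (1 - y_star $ i)) * ?g y_star $ i = 0"
    using kkt_point_complementarity[OF assms(4), of i] by simp
  moreover have "gradient (merit f \<sigma>) (x k) $ i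
      = \<sigma> $ i * (y k $ i * (1 - y k $ i)) * ?g (y k) $ i" for k
    using gradient_merit_nth[OF diff, of \<sigma> "x k" i] assms(5) by (simp add: warp)
  ultimately show "(\<lambda>k. gradient (merit f \<sigma>) (x k) $ i) \<longlonglongrightarrow> 0 $ i"
    by simp
qed

end
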